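(* For any $m \geq 0$ and $n \geq 0$, $$\#\mathsf{Av}_{\mathbf{m}}(n) = \mathrm{cat}_m(n), \qquad \text{where } \mathrm{cat}_m(n) := \frac{1}{mn+1}\binom{mn+n}{n}.$$
   Context: For integers $m, n \geq 0$, let $\mathbf{m}(i) := m(i-1)$ for $i \geq 1$. $\mathsf{Av}_{\mathbf{m}}(n)$ is the set of words $u = u_1 \cdots u_n$ of integers of length $n$ such that $0 \leq u_i \leq \mathbf{m}(i)$ for all $1 \leq i \leq n$ and $u_1 + \cdots + u_k \leq \mathbf{m}(k)$ for all $1 \leq k \leq n$ (the $\mathbf{m}$-avalanches of size $n$). *)

theory Defs
  imports Complex_Main
begin

(* Only the values at i \<ge> 1 are meaningful, so the truncated subtraction is harmless. *)
definition range_map :: "nat \<Rightarrow> nat \<Rightarrow> nat" where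
  "range_map m i = m * (i - 1)"

(* Letters are indexed from 1 in the informal notation, so u_i is u ! (i - 1). *)
definition avalanches :: "nat \<Rightarrow> nat \<Rightarrow> int list set" where
  "avalanches m n =
     {u. length u = n \<and>
         (\<forall>i\<in>{1..n}. 0 \<le> u ! (i - 1) \<and> u ! (i - 1) \<le> int (range_map m i)) \<and>
         (\<forall>k\<in>{1..n}. (\<Sum>i=1..k. u ! (i - 1)) \<le> int (range_map m k))}"

definition fuss_catalan :: "nat \<Rightarrow> nat \<Rightarrow> real" where
  "fuss_catalan m n = 1 / real (m * n + 1) * real ((m * n + n) choose n)"

end

theory Submission
  imports Defs
begin

text \<open>
  Relaxing the constraint on the partial sums makes it stable under removal of the first letter.
  Let \<open>S r n\<close> be the set of words of \<open>n\<close> nonnegative integers whose partial sums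
  satisfy \<open>u\<^sub>1 + \<dots> + u\<^sub>k < r + m (k - 1)\<close>; avalanches are the case \<open>r = 1\<close>. A word
  in \<open>S (r + 1) (n + 1)\<close> either begins with \<open>0\<close>, and then its tail is an arbitrary element of
  \<open>S (r + m + 1) n\<close>, since the bound moves up by \<open>m\<close> at each position; or it begins with a positive
  letter, and lowering this letter by one gives an arbitrary element of \<open>S r (n + 1)\<close>.
  Hence the cardinalities satisfy
  \<open>R (r + 1) (n + 1) = R (r + m + 1) n + R r (n + 1)\<close>
  with \<open>R 0 (n + 1) = 0\<close> and \<open>R r 0 = 1\<close> for \<open>r > 0\<close>. These equations are solved by the Raney (or
  two-parameter Fuss-Catalan) numbers
  \<open>R r n = r / ((m + 1) n + r) * binom ((m + 1) n + r, n)\<close>,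
  and \<open>R 1 n\<close> is the Fuss-Catalan number.
\<close>

text \<open>
  The strict inequality makes \<open>r = 0\<close> meaningful: there are then no nonempty words, which is
  the boundary value of the recursion.
\<close>

definition slack_words :: "nat \<Rightarrow> nat \<Rightarrow> nat \<Rightarrow> int list set" where
  "slack_words m r n =
     {u. length u = n \<and> (\<forall>x\<in>set u. 0 \<le> x) \<and>
         (\<forall>k<n. sum_list (take (Suc k) u) < int (r + m * k))}"

definition raney :: "nat \<Rightarrow> nat \<Rightarrow> nat \<Rightarrow> real" where
  "raney m r n = real r / real ((m + 1) * n + r) * real (((m + 1) * n + r) choose n)"

lemma slack_words_length_0: "slack_words m r 0 = {[]}"
  by (auto simp: slack_words_def)

lemma Cons_in_slack_words_iff:
  "x # v \<in> slack_words m r (Suc n) \<longleftrightarrow>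
     length v = n \<and> 0 \<le> x \<and> (\<forall>y\<in>set v. 0 \<le> y) \<and> x < int r \<and>
     (\<forall>k<n. x + sum_list (take (Suc k) v) < int (r + m + m * k))"
  unfolding slack_words_def by (auto simp: All_less_Suc2 algebra_simps)

lemma slack_words_no_slack: "slack_words m 0 (Suc n) = {}"
proof -
  have "x # v \<notin> slack_words m 0 (Suc n)" for x v
    by (simp add: Cons_in_slack_words_iff)
  moreover have "[] \<notin> slack_words m 0 (Suc n)"
    by (simp add: slack_words_def)
  ultimately show ?thesis
    by (metis equals0I neq_Nil_conv)
qed

text \<open>
  For a positive first letter, lowering it by one lowers every partial sum by one, so the slack
  drops by one and the length is unchanged.
\<close>

lemma slack_words_split:
  "slack_words m (Suc r) (Suc n) =
     (#) 0 ` slack_words m (r + m + 1) n \<union>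
     (\<lambda>u. (hd u + 1) # tl u) ` slack_words m r (Suc n)"
    (is "?L = ?Z \<union> ?P")
proof (intro equalityI subsetI)
  fix u assume u: "u \<in> ?L"
  then obtain x v where uv: "u = x # v"
    by (cases u) (auto simp: slack_words_def)
  show "u \<in> ?Z \<union> ?P"
  proof (cases "x = 0")
    case True
    then have "v \<in> slack_words m (r + m + 1) n"
      using u uv by (auto simp: Cons_in_slack_words_iff) (auto simp: slack_words_def algebra_simps)
    with uv True show ?thesis by simp
  next
    case False
    then have "(x - 1) # v \<in> slack_words m r (Suc n)"
      using u uv by (auto simp: Cons_in_slack_words_iff algebra_simps)
    then have "u \<in> ?P"
      by (rule rev_image_eqI) (simp add: uv)
    then show ?thesis ..
  qed
next
  fix u assume "u \<in> ?Z \<union> ?P"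
  then show "u \<in> ?L"
  proof
    assume "u \<in> ?Z"
    then show ?thesis
      by (auto simp: Cons_in_slack_words_iff) (auto simp: slack_words_def algebra_simps)
  next
    assume "u \<in> ?P"
    then obtain w where w: "w \<in> slack_words m r (Suc n)" "u = (hd w + 1) # tl w"
      by blast
    then obtain x v where "w = x # v"
      by (cases w) (auto simp: slack_words_def)
    with w show ?thesis
      by (auto simp: Cons_in_slack_words_iff algebra_simps)
  qed
qed

lemma finite_slack_words: "finite (slack_words m r n)"
proof (induction n arbitrary: r)
  case 0
  then show ?case by (simp add: slack_words_length_0)
next
  case (Suc n)
  show ?case
    by (induction r) (simp_all add: slack_words_no_slack slack_words_split Suc.IH)
qed

lemma card_slack_words_rec:
  "card (slack_words m (Suc r) (Suc n)) =
     card (slack_words m (r + m + 1) n) + card (slack_words m r (Suc n))"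
proof -
  let ?bump = "\<lambda>u :: int list. (hd u + 1) # tl u"
  have nonempty: "u \<noteq> []" "0 \<le> hd u" if "u \<in> slack_words m r (Suc n)" for u
    using that by (cases u; auto simp: slack_words_def)+
  have "inj_on ?bump (slack_words m r (Suc n))"
    by (rule inj_onI) (use nonempty in \<open>auto intro: list.expand\<close>)
  moreover have "(#) 0 ` slack_words m (r + m + 1) n \<inter> ?bump ` slack_words m r (Suc n) = {}"
    using nonempty(2) by fastforce
  ultimately show ?thesis
    unfolding slack_words_split
    by (simp add: card_Un_disjoint card_image finite_slack_words)
qed

text \<open>
  With \<open>N = (m + 1) (n + 1) + r\<close>, absorption expresses all three binomial coefficients
  through \<open>binom (N, n)\<close>. What remains is the identity
  \<open>N (r + 1) = r (N - n) + (r + m + 1) (n + 1)\<close>, which is where the value of \<open>N\<close> matters.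
\<close>

lemma raney_rec: "raney m (Suc r) (Suc n) = raney m (r + m + 1) n + raney m r (Suc n)"
proof -
  define N where "N = (m + 1) * (n + 1) + r"
  define b where "b = real (N choose n)"
  have n_le: "n \<le> N"
    by (simp add: N_def)
  have "0 < N"
    by (simp add: N_def)
  then have N_pos: "0 < real N"
    by simp
  have up: "real (Suc N choose Suc n) = real (N + 1) * b / real (n + 1)"
    using arg_cong[OF Suc_times_binomial[of n N], of real]
    by (simp add: b_def field_simps)
  have across: "real (N choose Suc n) = real (N - n) * b / real (n + 1)"
    using arg_cong[OF binomial_absorb_comp[of N n], of real]
      arg_cong[OF binomial_absorption[of n N], of real]
    by (simp add: b_def field_simps)
  have key: "real N * (real r + 1) =
      real r * real (N - n) + (real r + real m + 1) * (real n + 1)"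
    using n_le by (simp add: of_nat_diff) (simp add: N_def algebra_simps)
  have "raney m (Suc r) (Suc n) = (real r + 1) / real (N + 1) * real (Suc N choose Suc n)"
    by (simp add: raney_def N_def algebra_simps)
  also have "\<dots> = (real r + 1) * b / (real n + 1)"
    unfolding up by (simp add: divide_simps)
  also have "\<dots> = real N * (real r + 1) * b / (real N * (real n + 1))"
    using N_pos by simp
  also have "\<dots> = (real r + real m + 1) / real N * b
      + real r / real N * (real (N - n) * b / (real n + 1))"
    unfolding key using N_pos by (simp add: divide_simps) (simp add: algebra_simps)
  also have "\<dots> = raney m (r + m + 1) n + raney m r (Suc n)"
  proof -
    have "raney m (r + m + 1) n = (real r + real m + 1) / real N * b"
      by (simp add: raney_def N_def b_def algebra_simps)
    moreover have "raney m r (Suc n) = real r / real N * real (N choose Suc n)"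
      by (simp add: raney_def N_def algebra_simps)
    ultimately show ?thesis
      by (simp add: across add.commute)
  qed
  finally show ?thesis .
qed

text \<open>
  The case \<open>r = n = 0\<close> is excluded: the empty word satisfies the bounds for every \<open>r\<close>, whereas
  the closed form reads \<open>0 / 0\<close>, which is \<open>0\<close> by convention.
\<close>

lemma card_slack_words:
  assumes "0 < r + n"
  shows "real (card (slack_words m r n)) = raney m r n"
  using assms
proof (induction n arbitrary: r)
  case 0
  then show ?case by (simp add: slack_words_length_0 raney_def)
next
  case (Suc n)
  note shorter = Suc.IH
  show ?case
  proof (induction r)
    case 0
    show ?case by (simp add: slack_words_no_slack raney_def)
  next
    case (Suc r)
    then show ?case
      by (simp add: card_slack_words_rec raney_rec shorter)
  qed
qed

text \<open>
  The bound on individual letters in the definition of avalanches follows from the bound on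
  partial sums, because a nonnegative letter is at most the partial sum that ends with it.
\<close>

lemma avalanches_eq_slack_words: "avalanches m n = slack_words m 1 n"
proof -
  have partial_sum: "(\<Sum>i=1..Suc k. u ! (i - 1)) = sum_list (take (Suc k) u)"
    if "k < length u" for u :: "int list" and k
  proof -
    have "(\<Sum>i=1..Suc k. u ! (i - 1)) = (\<Sum>i<Suc k. u ! i)"
      by (rule sum.reindex_bij_witness[of _ Suc "\<lambda>i. i - 1"]) auto
    also have "\<dots> = sum_list (take (Suc k) u)"
      using that by (simp add: sum_list_sum_nth atLeast0LessThan)
    finally show ?thesis .
  qed
  have letter: "u ! k \<le> sum_list (take (Suc k) u)"
    if "\<forall>x\<in>set u. 0 \<le> x" "k < length u" for u :: "int list" and k
  proof -
    have "0 \<le> sum_list (take k u)"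
      using that(1) by (intro sum_list_nonneg) (auto dest: in_set_takeD)
    then show ?thesis
      using that(2) by (simp add: take_Suc_conv_app_nth)
  qed
  have shift: "(\<forall>i\<in>{1..n}. P i) \<longleftrightarrow> (\<forall>k<n. P (Suc k))" for P
    using image_Suc_lessThan[of n] by (metis (no_types, lifting) ball_simps(9) lessThan_iff)
  have "u \<in> avalanches m n \<longleftrightarrow> u \<in> slack_words m 1 n" for u
  proof (cases "length u = n")
    case False
    then show ?thesis by (simp add: avalanches_def slack_words_def)
  next
    case True
    have "u \<in> avalanches m n \<longleftrightarrow>
        (\<forall>k<n. 0 \<le> u ! k \<and> u ! k \<le> int (m * k)) \<and>
        (\<forall>k<n. sum_list (take (Suc k) u) \<le> int (m * k))"
      unfolding avalanches_def mem_Collect_eq shift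
      using True partial_sum[of _ u] by (simp add: range_map_def)
    also have "\<dots> \<longleftrightarrow> (\<forall>x\<in>set u. 0 \<le> x) \<and>
        (\<forall>k<n. sum_list (take (Suc k) u) \<le> int (m * k))"
      using True letter[of u] by (auto simp: all_set_conv_all_nth) (meson order_trans)
    also have "\<dots> \<longleftrightarrow> u \<in> slack_words m 1 n"
      using True by (auto simp: slack_words_def)
    finally show ?thesis .
  qed
  then show ?thesis by blast
qed

text \<open>
  The Raney number with \<open>r = 1\<close> has upper binomial index \<open>m n + n + 1\<close>; absorbing the factor
  \<open>1 / (m n + n + 1)\<close> lowers it to \<open>m n + n\<close>.
\<close>

lemma raney_1_eq_fuss_catalan: "raney m 1 n = fuss_catalan m n"
proof -
  have "(m * n + 1) * (Suc (m * n + n) choose n) = Suc (m * n + n) * ((m * n + n) choose n)"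
    using binomial_absorb_comp[of "Suc (m * n + n)" n] by simp
  from arg_cong[OF this, of real]
  have "real (m * n + 1) * real (Suc (m * n + n) choose n) =
      real (Suc (m * n + n)) * real ((m * n + n) choose n)"
    by (simp only: of_nat_mult)
  moreover have "raney m 1 n =
      1 / real (Suc (m * n + n)) * real (Suc (m * n + n) choose n)"
    by (simp add: raney_def algebra_simps)
  moreover have "0 < real (m * n + 1)" "0 < real (Suc (m * n + n))"
    by (simp_all only: of_nat_0_less_iff)
  moreover have "1 / b * x = 1 / a * y" if "a * x = b * y" "0 < a" "0 < b" for a b x y :: real
    using that by (simp add: field_simps)
  ultimately show ?thesis
    unfolding fuss_catalan_def by metis
qed

theorem proposition2p1p2:
  fixes m n :: nat
  shows "real (card (avalanches m n)) = fuss_catalan m n"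
  by (simp add: avalanches_eq_slack_words card_slack_words flip: raney_1_eq_fuss_catalan)

end
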